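(* For any integer $n\geq 1$ we have \[ R(Q_n(x),Q_{n-1}(x)) = 2^n\binom{2n}{n}^{n-2}. \]
   Context: For each integer $n\geq 0$, $P_n(x),Q_n(x)\in\mathbb{Q}[x]$ denote the unique pair of polynomials with $\deg P_n\leq n$, $\deg Q_n\leq n$ satisfying $P_n(x)x^{n+1}+Q_n(x)(x+1)^{n+1}=1$. For polynomials $f(x)=a_0(x-\alpha_1)\cdots(x-\alpha_\mu)$ with $a_0\neq0$ and $g$, the resultant (with respect to $x$) is $R(f,g)=a_0^{\deg g}\prod_{i=1}^\mu g(\alpha_i)$. *)

theory Defs
  imports "HOL-Computational_Algebra.Computational_Algebra"
    "HOL-Computational_Algebra.Field_as_Ring"
begin

definition is_PQ :: "nat \<Rightarrow> rat poly \<times> rat poly \<Rightarrow> bool" where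
  "is_PQ n = (\<lambda>(P, Q). degree P \<le> n \<and> degree Q \<le> n \<and>
     P * [:0, 1:] ^ (n + 1) + Q * [:1, 1:] ^ (n + 1) = 1)"

lemma is_PQ_ex1: "\<exists>!PQ. is_PQ n PQ"
proof -
  define X :: "rat poly" where "X = [:0, 1:] ^ (n + 1)"
  define Y :: "rat poly" where "Y = [:1, 1:] ^ (n + 1)"
  have dX: "degree X = n + 1"
    unfolding X_def by (subst degree_power_eq) auto
  have dY: "degree Y = n + 1"
    unfolding Y_def by (subst degree_power_eq) auto
  have X0: "X \<noteq> 0" and Y0: "Y \<noteq> 0"
    using dX dY by auto
  have "coprime [:0, 1::rat:] [:1, 1:]"
  proof (rule coprimeI)
    fix c :: "rat poly" assume "c dvd [:0, 1:]" "c dvd [:1, 1:]"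
    hence "c dvd [:1, 1:] - [:0, 1:]" by (rule dvd_diff[rotated])
    thus "is_unit c" by (simp add: one_pCons)
  qed
  hence cop: "coprime X Y"
    unfolding X_def Y_def by (simp only: coprime_power_left_iff coprime_power_right_iff simp_thms)
  have deg_le: "degree A \<le> n" if "A * Z = B" "degree B \<le> 2 * n + 1" "degree Z = n + 1" "Z \<noteq> 0"
    for A B Z :: "rat poly"
  proof (cases "A = 0")
    case False
    hence "degree B = degree A + (n + 1)"
      using that by (auto simp: degree_mult_eq)
    thus ?thesis using that by simp
  qed auto
  obtain u v where uv: "u * X + v * Y = 1"
    using cop bezout_coefficients_fst_snd[of X Y] by (metis coprime_iff_gcd_eq_1)
  define Q where "Q = v mod X"
  define P where "P = u + (v div X) * Y"
  have eq: "P * X + Q * Y = 1"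
  proof -
    have "v = v div X * X + Q" by (simp add: Q_def)
    hence "v * Y = v div X * X * Y + Q * Y"
      by (metis distrib_right)
    thus ?thesis using uv by (simp add: P_def algebra_simps)
  qed
  have dQ: "degree Q \<le> n"
    using degree_mod_less'[of X v] X0 dX unfolding Q_def by (cases "v mod X = 0") auto
  have dP: "degree P \<le> n"
  proof (rule deg_le)
    show "P * X = 1 - Q * Y" using eq by (simp add: algebra_simps)
    have "degree (Q * Y) \<le> 2 * n + 1"
      using degree_mult_le[of Q Y] dQ dY by simp
    thus "degree (1 - Q * Y) \<le> 2 * n + 1"
      by (intro degree_diff_le) auto
  qed (use dX X0 in auto)
  show ?thesis
  proof (rule ex1I[of _ "(P, Q)"])
    show "is_PQ n (P, Q)"
      using eq dP dQ by (simp only: is_PQ_def X_def Y_def prod.case simp_thms)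
  next
    fix PQ' assume PQ': "is_PQ n PQ'"
    obtain P' Q' where [simp]: "PQ' = (P', Q')" by (cases PQ')
    from PQ' have h: "degree P' \<le> n" "degree Q' \<le> n" "P' * X + Q' * Y = 1"
      by (simp_all only: is_PQ_def X_def Y_def prod.case \<open>PQ' = (P', Q')\<close>)
    have e: "(P' - P) * X = (Q - Q') * Y"
      using h(3) eq by (simp add: algebra_simps)
    hence "X dvd (Q - Q') * Y" by (metis dvd_triv_right)
    hence "X dvd Q - Q'" using cop by (simp add: coprime_dvd_mult_left_iff)
    moreover have "degree (Q - Q') \<le> n" using dQ h by (intro degree_diff_le)
    ultimately have "Q = Q'"
      using dX divides_degree[of X "Q - Q'"] by force
    with e X0 show "PQ' = (P, Q)" by simp
  qed
qed

definition PQ_pair :: "nat \<Rightarrow> rat poly \<times> rat poly" where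
  "PQ_pair n = (THE PQ. is_PQ n PQ)"

definition P_poly :: "nat \<Rightarrow> rat poly" where
  "P_poly n = fst (PQ_pair n)"

definition Q_poly :: "nat \<Rightarrow> rat poly" where
  "Q_poly n = snd (PQ_pair n)"

lemma PQ_poly:
  "degree (P_poly n) \<le> n" "degree (Q_poly n) \<le> n"
  "P_poly n * [:0, 1:] ^ (n + 1) + Q_poly n * [:1, 1:] ^ (n + 1) = 1"
proof -
  have "is_PQ n (PQ_pair n)"
    unfolding PQ_pair_def by (rule theI'[OF is_PQ_ex1])
  hence "is_PQ n (P_poly n, Q_poly n)"
    by (simp only: P_poly_def Q_poly_def prod.collapse)
  thus "degree (P_poly n) \<le> n" "degree (Q_poly n) \<le> n"
    "P_poly n * [:0, 1:] ^ (n + 1) + Q_poly n * [:1, 1:] ^ (n + 1) = 1"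
    by (simp_all only: is_PQ_def prod.case)
qed

text \<open>
  The resultant as a product over roots. Since \<open>proots f\<close> counts only the roots in the
  coefficient field, the definition is given over the complex numbers; rational polynomials
  are embedded by \<open>map_poly of_rat\<close>.
\<close>

definition root_resultant :: "complex poly \<Rightarrow> complex poly \<Rightarrow> complex" where
  "root_resultant f g = lead_coeff f ^ degree g * (\<Prod>\<alpha>\<in>#proots f. poly g \<alpha>)"

lemma root_resultant_factored:
  assumes "a \<noteq> 0"
  shows "root_resultant (smult a (\<Prod>\<alpha>\<leftarrow>as. [:-\<alpha>, 1:])) g = a ^ degree g * (\<Prod>\<alpha>\<leftarrow>as. poly g \<alpha>)"
proof -
  have "lead_coeff (\<Prod>\<alpha>\<leftarrow>as. [:-\<alpha>, 1:]) = (1 :: complex)"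
    by (induction as) (simp_all only: list.map prod_list.Nil prod_list.Cons lead_coeff_mult, simp_all)
  moreover have nz: "(\<Prod>\<alpha>\<leftarrow>as. [:-\<alpha>, 1:]) \<noteq> (0 :: complex poly)" for as
    by (auto simp: prod_list_zero_iff)
  have "proots (\<Prod>\<alpha>\<leftarrow>as. [:-\<alpha>, 1:]) = mset as"
    by (induction as)
      (simp_all only: list.map prod_list.Nil prod_list.Cons proots_mult nz pCons_eq_0_iff
        one_neq_zero simp_thms, simp_all)
  ultimately show ?thesis
    using assms by (simp add: root_resultant_def lead_coeff_smult flip: prod_mset_prod_list)
qed

end

theory Submission
  imports Defs
begin

text \<open>
  \<open>Q\<^sub>n\<close> is the truncation of \<open>(1 + x)\<^bsup>-(n+1)\<^esup>\<close> after \<open>x\<^sup>n\<close>, which gives its coefficients and,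
  with the leading coefficient \<open>d\<close> of \<open>Q\<^sub>n\<close>, the recurrence
  \<open>(1 + x) Q\<^sub>n = Q\<^bsub>n-1\<^esub> + d x\<^sup>n (1/2 + x)\<close>.
  Hence \<open>Q\<^bsub>n-1\<^esub>(\<alpha>) = -d \<alpha>\<^sup>n (1/2 + \<alpha>)\<close> at every root \<open>\<alpha>\<close> of \<open>Q\<^sub>n\<close>, so the product over the
  roots reduces to the two values \<open>Q\<^sub>n(0) = 1\<close> and \<open>Q\<^sub>n(-1/2)\<close>. The recurrence at \<open>x = -1/2\<close>
  shows that the latter doubles with each step, so it equals \<open>2\<^sup>n\<close>.
\<close>

lemma coeff_Q_poly:
  "coeff (Q_poly n) k = (if k \<le> n then (-1) ^ k * of_nat ((n + k) choose k) else 0)"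
proof (cases "k \<le> n")
  case True
  \<comment> \<open>The binomial series of (1 + x)^(-(n+1)), with which \<open>Q_poly n\<close>
    agrees up to x^n.\<close>
  define B where "B = fps_binomial (- of_nat (n + 1) :: rat)"
  have X1: "fps_of_poly [:1, 1 :: rat:] = 1 + fps_X"
    by (simp add: fps_of_poly_pCons)
  have "fps_of_poly (P_poly n) * fps_X ^ (n + 1) +
      fps_of_poly (Q_poly n) * (1 + fps_X) ^ (n + 1) = 1"
    using arg_cong[OF PQ_poly(3)[of n], of fps_of_poly]
    by (simp only: fps_of_poly_add fps_of_poly_mult fps_of_poly_power fps_of_poly_fps_X X1
        fps_of_poly_1)
  hence Q: "fps_of_poly (Q_poly n) * (1 + fps_X) ^ (n + 1) =
      1 - fps_of_poly (P_poly n) * fps_X ^ (n + 1)"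
    by (simp only: eq_diff_eq add.commute)
  have inv: "(1 + fps_X) ^ (n + 1) * B = 1"
    unfolding B_def fps_binomial_of_nat[symmetric] fps_binomial_add_mult[symmetric] by simp
  have "fps_of_poly (Q_poly n) = fps_of_poly (Q_poly n) * ((1 + fps_X) ^ (n + 1) * B)"
    by (simp only: inv mult_1_right)
  also have "\<dots> = (1 - fps_of_poly (P_poly n) * fps_X ^ (n + 1)) * B"
    by (simp only: Q mult.assoc[symmetric])
  also have "\<dots> = B - (fps_of_poly (P_poly n) * B) * fps_X ^ (n + 1)"
    by (simp only: algebra_simps mult_1_right)
  finally have "fps_of_poly (Q_poly n) $ k =
      (B - (fps_of_poly (P_poly n) * B) * fps_X ^ (n + 1)) $ k"
    by simp
  \<comment> \<open>The subtracted series is divisible by \<open>fps_X ^ (n + 1)\<close>, so it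
    cannot reach a coefficient with k \<le> n.\<close>
  also have "\<dots> = B $ k"
    using True by (simp only: fps_sub_nth fps_X_power_mult_right_nth) simp
  \<comment> \<open>Upper negation: -(n+1) choose k equals (-1)^k times n+k choose k.\<close>
  also have "\<dots> = (-1) ^ k * ((of_nat (n + k)) gchoose k)"
    unfolding B_def fps_binomial_nth gbinomial_minus by (simp add: algebra_simps)
  finally show ?thesis
    using True by (simp add: binomial_gbinomial)
qed (use PQ_poly(2)[of n] in \<open>simp add: coeff_eq_0\<close>)

abbreviation complex_Q_poly :: "nat \<Rightarrow> complex poly" where
  "complex_Q_poly n \<equiv> map_poly of_rat (Q_poly n)"

lemma coeff_complex_Q_poly:
  "coeff (complex_Q_poly n) k = (if k \<le> n then (-1) ^ k * of_nat ((n + k) choose k) else 0)"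
  by (simp add: coeff_map_poly coeff_Q_poly of_rat_mult of_rat_power)

lemma degree_complex_Q_poly: "degree (complex_Q_poly n) = n"
  by (rule order_antisym) (auto intro!: degree_le le_degree simp: coeff_complex_Q_poly)

lemma lead_coeff_complex_Q_poly:
  "lead_coeff (complex_Q_poly n) = (-1) ^ n * of_nat ((2 * n) choose n)"
  by (simp add: degree_complex_Q_poly coeff_complex_Q_poly mult_2)

lemma poly_complex_Q_poly_0: "poly (complex_Q_poly n) 0 = 1"
  by (simp add: poly_0_coeff_0 coeff_complex_Q_poly)

text \<open>Because the signs alternate, each coefficient on the left is, up to sign, a difference
  of binomials. Up to x^n Pascal's rule turns it into the coefficient of
  \<open>complex_Q_poly n\<close>; the monomial term accounts for the two top coefficients, at
  x^(n+1) and x^(n+2).\<close>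

lemma complex_Q_poly_recurrence:
  "[:1, 1:] * complex_Q_poly (Suc n) =
     complex_Q_poly n + monom (lead_coeff (complex_Q_poly (Suc n))) (Suc n) * [:1/2, 1:]"
proof (rule poly_eqI)
  fix k
  \<comment> \<open>This is where the constant 1/2 comes from: at x^(n+1) the difference of
    binomials is half the central one.\<close>
  have central: "of_nat (Suc (Suc (2 * n)) choose Suc n) =
      2 * (of_nat (Suc (2 * n) choose n) :: complex)"
    using binomial_symmetric[of n "Suc (2 * n)"] by simp
  have pascal: "(Suc n + Suc j) choose Suc j = (Suc n + j choose j) + (n + Suc j choose Suc j)" for j
    by simp
  show "coeff ([:1, 1:] * complex_Q_poly (Suc n)) k =
     coeff (complex_Q_poly n + monom (lead_coeff (complex_Q_poly (Suc n))) (Suc n) * [:1/2, 1:]) k"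
  proof (cases k)
    case 0
    thus ?thesis by (simp add: coeff_complex_Q_poly coeff_monom_mult)
  next
    case (Suc j)
    consider "j < n" | "j = n" | "j = Suc n" | "j > Suc n" by linarith
    thus ?thesis
    proof cases
      case 1
      thus ?thesis using Suc pascal[of j]
        by (simp add: coeff_complex_Q_poly coeff_monom_mult algebra_simps)
    next
      case 2
      thus ?thesis using Suc central
        by (simp add: coeff_complex_Q_poly coeff_monom_mult degree_complex_Q_poly
            mult_2[symmetric] del: binomial_Suc_Suc)
    next
      case 3
      thus ?thesis using Suc
        by (simp add: coeff_complex_Q_poly coeff_monom_mult degree_complex_Q_poly)
    next
      case 4
      thus ?thesis using Suc
        by (simp add: coeff_complex_Q_poly coeff_monom_mult coeff_pCons split: nat.split)
    qed
  qed
qed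

lemma poly_complex_Q_poly_recurrence:
  "(1 + x) * poly (complex_Q_poly (Suc n)) x =
     poly (complex_Q_poly n) x + lead_coeff (complex_Q_poly (Suc n)) * x ^ Suc n * (1/2 + x)"
  using arg_cong[OF complex_Q_poly_recurrence[of n], of "\<lambda>p. poly p x"]
  by (simp add: poly_monom algebra_simps del: power_Suc)

lemma poly_complex_Q_poly_neg_half: "poly (complex_Q_poly n) (-1/2) = 2 ^ n"
proof (induction n)
  case 0
  show ?case by (simp add: poly_altdef degree_complex_Q_poly coeff_complex_Q_poly)
next
  case (Suc n)
  \<comment> \<open>At -1/2 the term with factor 1/2 + x vanishes, and 1 + x = 1/2 gives the
    doubling.\<close>
  thus ?case using poly_complex_Q_poly_recurrence[of "-1/2" n] by (simp add: field_simps)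
qed

text \<open>Read from right to left, this evaluates a product of linear terms over all roots, with
  multiplicity, by a single value of \<open>p\<close>.\<close>

lemma poly_eq_prod_proots:
  "poly p x = lead_coeff p * (\<Prod>\<alpha>\<in>#proots p. x - \<alpha>)" for p :: "complex poly"
  by (subst complex_poly_decompose_multiset[of p, symmetric])
     (simp add: poly_prod_mset del: complex_poly_decompose_multiset)

lemma prod_mset_power: "(\<Prod>x\<in>#A. f x ^ n) = (\<Prod>x\<in>#A. f x :: 'a :: comm_monoid_mult) ^ n"
  by (induction A) (simp_all add: power_mult_distrib)

theorem theorem6p1:
  fixes n :: nat
  assumes "n \<ge> 1"
  shows "root_resultant (map_poly of_rat (Q_poly n)) (map_poly of_rat (Q_poly (n - 1)))
       = 2 ^ n * of_nat ((2 * n) choose n) powi (int n - 2)"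
proof -
  obtain m where n: "n = Suc m" using assms by (cases n) auto
  define f where "f = complex_Q_poly n"
  define c :: complex where "c = of_nat ((2 * n) choose n)"
  define d where "d = (-1) ^ n * c"
  have lead: "lead_coeff f = d"
    unfolding f_def d_def c_def by (rule lead_coeff_complex_Q_poly)
  have c0: "c \<noteq> 0" by (simp add: c_def)
  hence d0: "d \<noteq> 0" by (simp add: d_def)
  have f0: "f \<noteq> 0" using lead d0 by auto
  \<comment> \<open>The factors are written as x - \<alpha> for x = 0 and x = -1/2 to fit
    \<open>poly_eq_prod_proots\<close>. The sign of (0 - \<alpha>)^n cancels that of
    \<open>d\<close>, leaving \<open>c\<close>.\<close>
  have at_root: "poly (complex_Q_poly m) \<alpha> = c * ((0 - \<alpha>) ^ n * (-1/2 - \<alpha>))"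
    if "\<alpha> \<in># proots f" for \<alpha>
  proof -
    have "poly f \<alpha> = 0" using that f0 by simp
    hence "poly (complex_Q_poly m) \<alpha> = - (d * \<alpha> ^ n * (1/2 + \<alpha>))"
      using poly_complex_Q_poly_recurrence[of \<alpha> m] lead
      by (simp add: f_def n eq_neg_iff_add_eq_0 del: power_Suc)
    also have "\<dots> = c * ((0 - \<alpha>) ^ n * (-1/2 - \<alpha>))"
      by (simp add: d_def power_minus[of \<alpha>] algebra_simps)
    finally show ?thesis .
  qed
  have prod0: "(\<Prod>\<alpha>\<in>#proots f. 0 - \<alpha>) = 1 / d"
    using poly_eq_prod_proots[of f 0] d0
    by (simp add: lead poly_complex_Q_poly_0[of n, folded f_def] field_simps)
  have prod_half: "(\<Prod>\<alpha>\<in>#proots f. -1/2 - \<alpha>) = 2 ^ n / d"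
    using poly_eq_prod_proots[of f "-1/2"] d0
    unfolding lead poly_complex_Q_poly_neg_half[of n, folded f_def] by simp
  have size: "size (proots f) = n"
    by (simp add: size_proots_complex f_def degree_complex_Q_poly)
  have "(\<Prod>\<alpha>\<in>#proots f. poly (complex_Q_poly m) \<alpha>) =
      (\<Prod>\<alpha>\<in>#proots f. c * ((0 - \<alpha>) ^ n * (-1/2 - \<alpha>)))"
    using at_root by (intro arg_cong[where f = prod_mset] image_mset_cong)
  also have "\<dots> = c ^ n * ((1 / d) ^ n * (2 ^ n / d))"
    by (simp only: prod_mset.distrib prod_mset_power prod0 prod_half image_mset_const_eq
        prod_mset_replicate_mset size)
  finally have "root_resultant f (complex_Q_poly m) = d ^ m * (c ^ n * ((1 / d) ^ n * (2 ^ n / d)))"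
    by (simp add: root_resultant_def lead degree_complex_Q_poly)
  \<comment> \<open>With n = m + 1 the powers of \<open>d\<close> collect to exponent m - n - 1 =
    -2, an even one, so the sign of \<open>d\<close> drops out next.\<close>
  also have "\<dots> = 2 ^ n * (c ^ n / d ^ 2)"
    using d0 by (simp add: n field_simps power2_eq_square)
  also have "d ^ 2 = c ^ 2"
    by (simp add: d_def power_mult_distrib flip: power_mult)
  \<comment> \<open>For n = 1 the exponent is -1, hence an integer power of the nonzero
    \<open>c\<close>.\<close>
  also have "c ^ n / c ^ 2 = c powi (int n - 2)"
    using c0 by (simp add: power_int_diff)
  finally show ?thesis
    by (simp add: f_def c_def n)
qed

end
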